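(* Let $X$ be a compact metric space. If $X^{slc}\neq\emptyset$, then $A(f)\neq\emptyset$ for every homeomorphism $f:X\to X$ satisfying property (CW).
   Context: Let $(X,d)$ be a compact metric space and $f:X\to X$ a homeomorphism; $f^n$ denotes the $n$-th iterate for $n\in\mathbb{Z}$. For $p\in X$ and nonempty $B\subset X$, $dist(p,B)=\inf\{d(p,b):b\in B\}$. A subcontinuum of $X$ is a nonempty compact connected subset of $X$. $f$ satisfies property (CW) if $\inf_{n\in\mathbb{Z}}dist(f^n(x),f^n(C))>0$ for every $x\in X$ and every subcontinuum $C$ of $X$ with $x\notin C$. $X$ is semi-locally connected at $p\in X$ if for every open neighborhood $U$ of $p$ there is an open neighborhood $V\subset U$ of $p$ such that $X\setminus U$ is contained in the union of finitely many connected components of $X\setminus V$. $X^{slc}$ denotes the set of points at which $X$ is semi-locally connected. A point $x\in X$ is almost automorphic (for $f$) if for every sequence $n_i\in\mathbb{Z}$ with $f^{n_i}(x)\to y$ for some $y\in X$ it holds that $f^{-n_i}(y)\to x$. $A(f)$ denotes the set of almost automorphic points of $f$. *)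

theory Defs
  imports "HOL-Analysis.Analysis"
begin

text \<open>
  The compact metric space is a compact set \<open>X\<close> in a metric type, with the subspace metric.
  A self-map of \<open>X\<close> is a function on the ambient type whose values outside \<open>X\<close> are irrelevant;
  hence inverses are taken with \<open>inv_into X\<close>.
\<close>

definition int_iterate :: "'a set \<Rightarrow> ('a \<Rightarrow> 'a) \<Rightarrow> int \<Rightarrow> 'a \<Rightarrow> 'a" where
  "int_iterate X f n = (if n \<ge> 0 then f ^^ nat n else inv_into X f ^^ nat (- n))"

definition subcontinuum :: "'a::metric_space set \<Rightarrow> 'a set \<Rightarrow> bool" where
  "subcontinuum X C \<longleftrightarrow> C \<subseteq> X \<and> C \<noteq> {} \<and> compact C \<and> connected C"

definition property_CW :: "'a::metric_space set \<Rightarrow> ('a \<Rightarrow> 'a) \<Rightarrow> bool" where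
  "property_CW X f \<longleftrightarrow>
     (\<forall>x\<in>X. \<forall>C. subcontinuum X C \<and> x \<notin> C \<longrightarrow>
        (INF n\<in>(UNIV :: int set). infdist (int_iterate X f n x) (int_iterate X f n ` C)) > 0)"

definition semi_locally_connected_at :: "'a::metric_space set \<Rightarrow> 'a \<Rightarrow> bool" where
  "semi_locally_connected_at X p \<longleftrightarrow>
     (\<forall>U. openin (top_of_set X) U \<and> p \<in> U \<longrightarrow>
        (\<exists>V. openin (top_of_set X) V \<and> p \<in> V \<and> V \<subseteq> U \<and>
           (\<exists>\<F>. finite \<F> \<and> \<F> \<subseteq> components (X - V) \<and> X - U \<subseteq> \<Union>\<F>)))"

definition slc_points :: "'a::metric_space set \<Rightarrow> 'a set" where
  "slc_points X = {p \<in> X. semi_locally_connected_at X p}"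

definition almost_automorphic :: "'a::metric_space set \<Rightarrow> ('a \<Rightarrow> 'a) \<Rightarrow> 'a \<Rightarrow> bool" where
  "almost_automorphic X f x \<longleftrightarrow>
     (\<forall>n :: nat \<Rightarrow> int. \<forall>y\<in>X.
        (\<lambda>i. int_iterate X f (n i) x) \<longlonglongrightarrow> y \<longrightarrow>
        (\<lambda>i. int_iterate X f (- n i) y) \<longlonglongrightarrow> x)"

definition almost_automorphic_points :: "'a::metric_space set \<Rightarrow> ('a \<Rightarrow> 'a) \<Rightarrow> 'a set" where
  "almost_automorphic_points X f = {x \<in> X. almost_automorphic X f x}"

end

theory Submission
  imports Defs
begin

text \<open>
  Every point \<open>p\<close> of semi-local connectedness is almost automorphic. If \<open>f\<^sup>n p\<close> tends to \<open>y\<close> along a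
  sequence of exponents while \<open>f\<^sup>-\<^sup>n y\<close> stays off a neighbourhood of \<open>p\<close>, then, the complement of
  that neighbourhood being covered by finitely many continua missing \<open>p\<close>, a single such continuum
  \<open>C\<close> contains \<open>f\<^sup>-\<^sup>n y\<close> for infinitely many terms of the sequence. For these \<open>y \<in> f\<^sup>n C\<close>, so
  the distance from \<open>f\<^sup>n p\<close> to \<open>f\<^sup>n C\<close> is not bounded away from zero.
\<close>

lemma bij_betw_int_iterate:
  assumes "bij_betw f X X"
  shows "bij_betw (int_iterate X f n) X X"
  unfolding int_iterate_def
  by (simp add: assms bij_betw_funpow bij_betw_inv_into)

lemma int_iterate_uminus_cancel:
  assumes f: "bij_betw f X X" and y: "y \<in> X"
  shows "int_iterate X f n (int_iterate X f (- n) y) = y"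
proof -
  let ?g = "inv_into X f"
  \<comment> \<open>Stated for an arbitrary pair, since the sign of \<open>n\<close> decides which
    of \<open>f\<close> and \<open>?g\<close> is the outer map.\<close>
  have funpow_cancel: "(h ^^ k) ((h' ^^ k) y) = y"
    if "\<And>x. x \<in> X \<Longrightarrow> h (h' x) = x" "bij_betw h' X X" for h h' :: "'a \<Rightarrow> 'a" and k
  proof (induction k)
    case (Suc k)
    \<comment> \<open>The cancellation \<open>h (h' x) = x\<close> is assumed on \<open>X\<close>
      only; the induction step uses it at this point.\<close>
    have "(h' ^^ k) y \<in> X"
      using bij_betw_funpow[OF that(2)] y bij_betwE by blast
    then show ?case
      using Suc that(1) by (simp add: funpow_swap1[of h])
  qed simp
  have g: "bij_betw ?g X X"
    by (rule bij_betw_inv_into[OF f])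
  show ?thesis
    using funpow_cancel[of f ?g, OF _ g] funpow_cancel[of ?g f, OF _ f]
      bij_betw_inv_into_left[OF f] bij_betw_inv_into_right[OF f]
    by (auto simp: int_iterate_def)
qed

lemma slc_point_almost_automorphic:
  assumes X: "compact X" and f: "bij_betw f X X" and CW: "property_CW X f"
    and p: "p \<in> slc_points X"
  shows "almost_automorphic X f p"
  unfolding almost_automorphic_def
proof (intro allI ballI impI)
  fix n :: "nat \<Rightarrow> int" and y
  let ?F = "int_iterate X f"
  assume y: "y \<in> X" and lim: "(\<lambda>i. ?F (n i) p) \<longlonglongrightarrow> y"
  have pX: "p \<in> X" and slc: "semi_locally_connected_at X p"
    using p by (auto simp: slc_points_def)
  have inX: "?F (- n i) y \<in> X" for i
    using bij_betwE[OF bij_betw_int_iterate[OF f]] y by blast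
  have avoid: "\<forall>\<^sub>F i in sequentially. ?F (- n i) y \<notin> C" if C: "subcontinuum X C" "p \<notin> C" for C
  proof -
    \<comment> \<open>Property (CW) makes this threshold positive; being uniform in the exponent, it
      serves every \<open>n i\<close> at once.\<close>
    define \<delta> where "\<delta> = (INF m. infdist (?F m p) (?F m ` C))"
    have "\<delta> > 0"
      using CW C pX by (auto simp: property_CW_def \<delta>_def)
    with lim have "\<forall>\<^sub>F i in sequentially. dist (?F (n i) p) y < \<delta>"
      by (rule tendstoD)
    then show ?thesis
    proof eventually_elim
      case (elim i)
      show ?case
      proof
        assume "?F (- n i) y \<in> C"
        then have "y \<in> ?F (n i) ` C"
          using int_iterate_uminus_cancel[OF f y, of "n i"] by (metis imageI)
        then have "infdist (?F (n i) p) (?F (n i) ` C) \<le> dist (?F (n i) p) y"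
          by (rule infdist_le)
        moreover have "\<delta> \<le> infdist (?F (n i) p) (?F (n i) ` C)"
          unfolding \<delta>_def by (rule cINF_lower) (auto intro!: bdd_belowI2[where m = 0] infdist_nonneg)
        ultimately show False
          using elim by linarith
      qed
    qed
  qed
  show "(\<lambda>i. ?F (- n i) y) \<longlonglongrightarrow> p"
  proof (rule topological_tendstoI)
    fix U assume "open U" "p \<in> U"
    then have "openin (top_of_set X) (X \<inter> U)" "p \<in> X \<inter> U"
      using pX by (auto simp: openin_open_Int)
    with slc obtain V \<F> where V: "openin (top_of_set X) V" "p \<in> V"
      and \<F>: "finite \<F>" "\<F> \<subseteq> components (X - V)" "X - X \<inter> U \<subseteq> \<Union>\<F>"
      unfolding semi_locally_connected_at_def by metis
    \<comment> \<open>Components are closed in \<open>X - V\<close>, so its compactness passes to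
      them; they miss \<open>p\<close> because \<open>p \<in> V\<close>.\<close>
    have "compact (X - V)"
      using V(1) X
      by (metis closedin_compact closedin_diff closedin_topspace topspace_euclidean_subtopology)
    then have "subcontinuum X C \<and> p \<notin> C" if "C \<in> \<F>" for C
    proof -
      have "C \<in> components (X - V)"
        using that \<F>(2) by blast
      then show ?thesis
        using \<open>compact (X - V)\<close> V(2) in_components_subset[of C "X - V"]
        by (auto simp: subcontinuum_def in_components_connected in_components_nonempty
            intro: closedin_compact closedin_component)
    qed
    \<comment> \<open>Finiteness of \<open>\<F>\<close> yields one tail avoiding all its members,
      the direct form of the pigeonhole choice of a single \<open>C\<close>.\<close>
    then have "\<forall>\<^sub>F i in sequentially. \<forall>C\<in>\<F>. ?F (- n i) y \<notin> C"
      using \<F>(1) avoid by (simp add: eventually_ball_finite)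
    then show "\<forall>\<^sub>F i in sequentially. ?F (- n i) y \<in> U"
      by eventually_elim (use inX \<F>(3) in blast)
  qed
qed

theorem corollary1p7:
  fixes X :: "'a::metric_space set"
  assumes "compact X"
    and "slc_points X \<noteq> {}"
  shows "\<forall>f. (\<exists>g. homeomorphism X X f g) \<and> property_CW X f \<longrightarrow>
             almost_automorphic_points X f \<noteq> {}"
proof (intro allI impI)
  fix f assume f: "(\<exists>g. homeomorphism X X f g) \<and> property_CW X f"
  obtain p where p: "p \<in> slc_points X"
    using assms(2) by blast
  have "bij_betw f X X"
    using f by (auto simp: bij_betw_def dest: homeomorphism_image1 homeomorphism_apply1 intro: inj_on_inverseI)
  then have "almost_automorphic X f p"
    using slc_point_almost_automorphic assms(1) f p by blast
  then show "almost_automorphic_points X f \<noteq> {}"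
    using p by (auto simp: almost_automorphic_points_def slc_points_def)
qed

end
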